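(* For every integer $n \geqslant 9$, $m(n,2,1,3) = n-4$. That is, every $2$-colouring of $E(K_n)$ has a monochromatic $3$-connected subgraph on at least $n-4$ vertices, and some $2$-colouring of $E(K_n)$ has no monochromatic $3$-connected subgraph on more than $n-4$ vertices.
   Context: A graph on at least $k+1$ vertices is $k$-connected if deleting any set of at most $k-1$ of its vertices leaves a connected graph. For $n\geqslant 2$ and $r,k\in\mathbb{N}$, $m(n,r,1,k)$ denotes the minimum, over all colourings $f:E(K_n)\to[r]$, of the maximum number of vertices of a subgraph $H\subseteq K_n$ that is $k$-connected and on whose edges $f$ is constant (the maximum is $0$ if no such subgraph exists). *)

theory Defs
  imports Main "HOL-Library.FuncSet"
begin

text \<open>
  A simple graph is a pair of a vertex set and an edge set, whose edges are
  two-element sets of vertices.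
\<close>

type_synonym 'a ugraph = "'a set \<times> 'a set set"

definition all_edges :: "'a set \<Rightarrow> 'a set set" where
  "all_edges V = {e. e \<subseteq> V \<and> card e = 2}"

definition wf_ugraph :: "'a ugraph \<Rightarrow> bool" where
  "wf_ugraph G \<longleftrightarrow> snd G \<subseteq> all_edges (fst G)"

definition subgraph :: "'a ugraph \<Rightarrow> 'a ugraph \<Rightarrow> bool" where
  "subgraph H G \<longleftrightarrow> wf_ugraph H \<and> fst H \<subseteq> fst G \<and> snd H \<subseteq> snd G"

definition delete_verts :: "'a ugraph \<Rightarrow> 'a set \<Rightarrow> 'a ugraph" where
  "delete_verts G S = (fst G - S, {e \<in> snd G. e \<inter> S = {}})"

definition connected_ugraph :: "'a ugraph \<Rightarrow> bool" where
  "connected_ugraph G \<longleftrightarrow>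
     fst G \<noteq> {} \<and> (\<forall>u\<in>fst G. \<forall>v\<in>fst G. (u, v) \<in> {(x, y). {x, y} \<in> snd G}\<^sup>*)"

text \<open>
  The bound ``at most \<open>k - 1\<close> vertices'' is written as \<open>card S < k\<close>,
  because subtraction on \<^typ>\<open>nat\<close> truncates at \<open>k = 0\<close>.
\<close>

definition k_connected :: "nat \<Rightarrow> 'a ugraph \<Rightarrow> bool" where
  "k_connected k G \<longleftrightarrow>
     finite (fst G) \<and> k + 1 \<le> card (fst G) \<and>
     (\<forall>S. S \<subseteq> fst G \<and> card S < k \<longrightarrow> connected_ugraph (delete_verts G S))"

definition complete_ugraph :: "nat \<Rightarrow> nat ugraph" where
  "complete_ugraph n = ({1..n}, all_edges {1..n})"

definition colourings :: "nat \<Rightarrow> nat \<Rightarrow> (nat set \<Rightarrow> nat) set" where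
  "colourings n r = snd (complete_ugraph n) \<rightarrow>\<^sub>E {1..r}"

definition monochromatic :: "('a set \<Rightarrow> nat) \<Rightarrow> 'a ugraph \<Rightarrow> bool" where
  "monochromatic f H \<longleftrightarrow> (\<exists>c. \<forall>e\<in>snd H. f e = c)"

text \<open>Inserting 0 gives the value 0 when there is no such subgraph.\<close>

definition max_mono_order :: "nat \<Rightarrow> nat \<Rightarrow> (nat set \<Rightarrow> nat) \<Rightarrow> nat" where
  "max_mono_order n k f =
     Max (insert 0 {card (fst H) | H.
       subgraph H (complete_ugraph n) \<and> k_connected k H \<and> monochromatic f H})"

text \<open>The quantity \<open>m(n, r, s, k)\<close> for \<open>s = 1\<close>.\<close>

definition m1 :: "nat \<Rightarrow> nat \<Rightarrow> nat \<Rightarrow> nat" where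
  "m1 n r k = Min (max_mono_order n k ` colourings n r)"

end

theory Submission imports Defs begin

text \<open>
  A colouring is a symmetric relation \<open>r\<close> (red) together with its complement (blue). If neither
  has a 3-connected subgraph on \<open>n - 4\<close> vertices, then a red cut of a set of at least \<open>n - 2\<close>
  vertices by 2 vertices has a side of size at most 2, since otherwise the two sides span a
  3-connected complete bipartite blue graph. So red edges can be peeled off, a vertex or a pair of
  vertices at a time, losing few edges in each step, and the same holds for blue. For
  \<open>n = 9, 10, 11\<close> this leaves fewer than \<open>n (n - 1) / 2\<close> edges altogether. For \<open>n \<ge> 12\<close> induction
  provides, say, a red 3-connected \<open>H\<close> on \<open>n - 5\<close> vertices. Each of the five vertices outside has at
  most 2 red neighbours in \<open>H\<close>, and two vertices of \<open>H\<close> of small blue degree account for at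
  least 6 of these at most 10 red edges. Without these two, and possibly one more vertex of \<open>H\<close>,
  the blue edges between \<open>H\<close> and its complement form a 3-connected graph on at least \<open>n - 3\<close>
  vertices.

  For the upper bound, four vertices have degree 2 in one colour and four others have degree 2 in
  the other.
\<close>

section \<open>Cuts and 3-connectedness\<close>

definition sep :: "('a \<Rightarrow> 'a \<Rightarrow> bool) \<Rightarrow> 'a set \<Rightarrow> 'a set \<Rightarrow> 'a set \<Rightarrow> 'a set \<Rightarrow> bool" where
  "sep r U P Q S \<longleftrightarrow> P \<union> Q \<union> S = U \<and> P \<inter> Q = {} \<and> P \<inter> S = {} \<and> Q \<inter> S = {} \<and>
     P \<noteq> {} \<and> Q \<noteq> {} \<and> card S \<le> 2 \<and> (\<forall>p\<in>P. \<forall>q\<in>Q. \<not> r p q)"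

definition conn3 :: "('a \<Rightarrow> 'a \<Rightarrow> bool) \<Rightarrow> 'a set \<Rightarrow> bool" where
  "conn3 r U \<longleftrightarrow> finite U \<and> 4 \<le> card U \<and> (\<nexists>P Q S. sep r U P Q S)"

lemma sep_swap: "symp r \<Longrightarrow> sep r U P Q S \<Longrightarrow> sep r U Q P S"
  unfolding sep_def by (metis Int_commute Un_commute sympD)

lemma sep_finite:
  assumes "sep r U P Q S" "finite U"
  shows "finite P" "finite Q" "finite S"
  using assms unfolding sep_def by auto

lemma sep_card:
  assumes "sep r U P Q S" "finite U"
  shows "card U = card P + card Q + card S"
proof -
  note fin = sep_finite[OF assms]
  have "card (P \<union> Q \<union> S) = card (P \<union> Q) + card S"
    using assms fin by (intro card_Un_disjoint) (auto simp: sep_def)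
  moreover have "card (P \<union> Q) = card P + card Q"
    using assms fin by (intro card_Un_disjoint) (auto simp: sep_def)
  ultimately show ?thesis using assms by (simp add: sep_def)
qed

lemma sep_pad:
  assumes "symp r" "finite U" "4 \<le> card U" "sep r U P Q S"
  shows "\<exists>P Q S. sep r U P Q S \<and> card S = 2 \<and> card P \<le> card Q"
  using assms(4)
proof (induction "2 - card S" arbitrary: P Q S rule: less_induct)
  case less
  note fin = sep_finite[OF less.prems assms(2)]
  have cards: "card U = card P + card Q + card S" "card S \<le> 2"
    using sep_card[OF less.prems assms(2)] less.prems by (simp_all add: sep_def)
  obtain P' Q' where s: "sep r U P' Q' S" "card P' \<le> card Q'"
    and c: "card U = card P' + card Q' + card S" and f: "finite Q'" "finite P'"
  proof (cases "card P \<le> card Q")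
    case True
    then show ?thesis using that less.prems cards fin by blast
  next
    case False
    then show ?thesis using that[of Q P] sep_swap[OF assms(1) less.prems] cards fin by simp
  qed
  show ?case
  proof (cases "card S = 2")
    case True
    then show ?thesis using s by blast
  next
    case False
    then have S: "card S < 2" using cards by simp
    then have "2 \<le> card Q'" using c s(2) assms(3) by linarith
    then obtain q where q: "q \<in> Q'" by fastforce
    have "card (Q' - {q}) \<noteq> 0" using \<open>2 \<le> card Q'\<close> q f by simp
    then have ne: "Q' - {q} \<noteq> {}" by force
    have "q \<notin> S" using q s by (auto simp: sep_def)
    then have c1: "card (insert q S) = Suc (card S)" using fin by simp
    have "sep r U P' (Q' - {q}) (insert q S)"
      using s ne q c1 S unfolding sep_def by auto
    moreover have "2 - card (insert q S) < 2 - card S" using c1 S by simp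
    ultimately show ?thesis using less.hyps by blast
  qed
qed

lemma not_conn3E:
  assumes "\<not> conn3 r U" "symp r" "finite U" "4 \<le> card U"
  obtains P Q S where "P \<union> Q \<union> S = U" "P \<inter> Q = {}" "P \<inter> S = {}" "Q \<inter> S = {}"
    "P \<noteq> {}" "Q \<noteq> {}" "card S = 2" "card P \<le> card Q" "\<And>p q. p \<in> P \<Longrightarrow> q \<in> Q \<Longrightarrow> \<not> r p q"
    "card U = card P + card Q + 2" "finite P" "finite Q" "finite S"
proof -
  obtain P Q S where s: "sep r U P Q S" "card S = 2" "card P \<le> card Q"
    using assms sep_pad unfolding conn3_def by metis
  note fin = sep_finite[OF s(1) assms(3)]
  have "card U = card P + card Q + 2"
    using sep_card[OF s(1) assms(3)] s(2) by simp
  with s fin that show thesis unfolding sep_def by blast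
qed

lemma mult_ge_sum_minus_one:
  fixes a b :: nat
  assumes "a > 0" "b > 0"
  shows "a + b \<le> a * b + 1"
proof -
  obtain c d where "a = Suc c" "b = Suc d" using assms by (meson gr0_implies_Suc)
  then show ?thesis by simp
qed

lemma conn3_bipartite:
  assumes "symp r" "finite X" "finite Y" "X \<inter> Y = {}"
    and X: "\<And>x. x \<in> X \<Longrightarrow> card {y \<in> Y. \<not> r x y} + 3 \<le> card Y"
    and Y: "\<And>y. y \<in> Y \<Longrightarrow> card {x \<in> X. \<not> r x y} + 3 \<le> card X"
    and M: "card {(x, y). x \<in> X \<and> y \<in> Y \<and> \<not> r x y} + 4 < card X + card Y"
  shows "conn3 r (X \<union> Y)"
  unfolding conn3_def
proof (intro conjI notI)
  show "finite (X \<union> Y)" using assms by simp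
  show "4 \<le> card (X \<union> Y)" using M assms by (simp add: card_Un_disjoint)
  assume "\<exists>P Q S. sep r (X \<union> Y) P Q S"
  then obtain P Q S where s: "P \<union> Q \<union> S = X \<union> Y" "P \<inter> Q = {}" "P \<inter> S = {}" "Q \<inter> S = {}"
     "P \<noteq> {}" "Q \<noteq> {}" "card S \<le> 2" and no: "\<And>p q. p \<in> P \<Longrightarrow> q \<in> Q \<Longrightarrow> \<not> r p q"
    unfolding sep_def by blast
  have no': "\<not> r q p" if "p \<in> P" "q \<in> Q" for p q using no that assms(1) by (meson sympD)
  have fin: "finite P" "finite Q" "finite S"
    using s assms by (metis finite_Un)+
  have part: "card Z = card (P \<inter> Z) + card (Q \<inter> Z) + card (S \<inter> Z)" if "Z \<subseteq> X \<union> Y" for Z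
  proof -
    have "Z = (P \<inter> Z) \<union> (Q \<inter> Z) \<union> (S \<inter> Z)" using s that by blast
    then have "card Z = card ((P \<inter> Z) \<union> (Q \<inter> Z) \<union> (S \<inter> Z))" by simp
    also have "\<dots> = card ((P \<inter> Z) \<union> (Q \<inter> Z)) + card (S \<inter> Z)"
      using s fin by (intro card_Un_disjoint) auto
    also have "card ((P \<inter> Z) \<union> (Q \<inter> Z)) = card (P \<inter> Z) + card (Q \<inter> Z)"
      using s fin by (intro card_Un_disjoint) auto
    finally show ?thesis .
  qed
  have cX: "card X = card (P \<inter> X) + card (Q \<inter> X) + card (S \<inter> X)"
    and cY: "card Y = card (P \<inter> Y) + card (Q \<inter> Y) + card (S \<inter> Y)"
    by (rule part; blast)+
  have "card S = card (S \<inter> X \<union> S \<inter> Y)"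
    using s by (metis Int_Un_distrib Un_upper2 inf.absorb1)
  also have "\<dots> = card (S \<inter> X) + card (S \<inter> Y)"
    using fin assms by (intro card_Un_disjoint) auto
  finally have cS: "card (S \<inter> X) + card (S \<inter> Y) \<le> 2" using s by simp
  have bX: "card A + 3 \<le> card X" if "y \<in> Y" "A \<subseteq> {x \<in> X. \<not> r x y}" for A y
    using Y[OF that(1)] card_mono[OF _ that(2)] assms by simp
  have bY: "card A + 3 \<le> card Y" if "x \<in> X" "A \<subseteq> {y \<in> Y. \<not> r x y}" for A x
    using X[OF that(1)] card_mono[OF _ that(2)] assms by simp
  have ne: "P \<inter> X \<noteq> {}" "Q \<inter> X \<noteq> {}" "P \<inter> Y \<noteq> {}" "Q \<inter> Y \<noteq> {}"
  proof -
    show "P \<inter> X \<noteq> {}"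
    proof
      assume e: "P \<inter> X = {}"
      then obtain v where "v \<in> P" "v \<in> Y" using s by blast
      then have "card (Q \<inter> X) + 3 \<le> card X" using no' by (intro bX[of v]) auto
      then show False using e cX cS by simp
    qed
    show "Q \<inter> X \<noteq> {}"
    proof
      assume e: "Q \<inter> X = {}"
      then obtain v where "v \<in> Q" "v \<in> Y" using s by blast
      then have "card (P \<inter> X) + 3 \<le> card X" using no by (intro bX[of v]) auto
      then show False using e cX cS by simp
    qed
    show "P \<inter> Y \<noteq> {}"
    proof
      assume e: "P \<inter> Y = {}"
      then obtain v where "v \<in> P" "v \<in> X" using s by blast
      then have "card (Q \<inter> Y) + 3 \<le> card Y" using no by (intro bY[of v]) auto
      then show False using e cY cS by simp
    qed
    show "Q \<inter> Y \<noteq> {}"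
    proof
      assume e: "Q \<inter> Y = {}"
      then obtain v where "v \<in> Q" "v \<in> X" using s by blast
      then have "card (P \<inter> Y) + 3 \<le> card Y" using no' by (intro bY[of v]) auto
      then show False using e cY cS by simp
    qed
  qed
  let ?M = "{(x, y). x \<in> X \<and> y \<in> Y \<and> \<not> r x y}"
  have "?M \<subseteq> X \<times> Y" by auto
  then have finM: "finite ?M" using assms by (meson finite_SigmaI finite_subset)
  have "(P \<inter> X) \<times> (Q \<inter> Y) \<union> (Q \<inter> X) \<times> (P \<inter> Y) \<subseteq> ?M" using no no' by auto
  then have "card ((P \<inter> X) \<times> (Q \<inter> Y) \<union> (Q \<inter> X) \<times> (P \<inter> Y)) \<le> card ?M"
    using finM by (simp add: card_mono)
  moreover have "card ((P \<inter> X) \<times> (Q \<inter> Y) \<union> (Q \<inter> X) \<times> (P \<inter> Y)) =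
      card (P \<inter> X) * card (Q \<inter> Y) + card (Q \<inter> X) * card (P \<inter> Y)"
    using fin s by (subst card_Un_disjoint) (auto simp: card_cartesian_product)
  moreover have "card (P \<inter> X) + card (Q \<inter> Y) \<le> card (P \<inter> X) * card (Q \<inter> Y) + 1"
    using ne fin by (intro mult_ge_sum_minus_one) (auto simp: card_gt_0_iff)
  moreover have "card (Q \<inter> X) + card (P \<inter> Y) \<le> card (Q \<inter> X) * card (P \<inter> Y) + 1"
    using ne fin by (intro mult_ge_sum_minus_one) (auto simp: card_gt_0_iff)
  ultimately show False using cX cY cS M by linarith
qed

lemma conn3_complete_bipartite:
  assumes "symp r" "finite X" "finite Y" "X \<inter> Y = {}" "3 \<le> card X" "3 \<le> card Y"
    and "\<And>x y. x \<in> X \<Longrightarrow> y \<in> Y \<Longrightarrow> r x y"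
  shows "conn3 r (X \<union> Y)"
proof (rule conn3_bipartite)
  have "{(x, y). x \<in> X \<and> y \<in> Y \<and> \<not> r x y} = {}" using assms by auto
  then show "card {(x, y). x \<in> X \<and> y \<in> Y \<and> \<not> r x y} + 4 < card X + card Y"
    using assms by (simp only: card.empty)
  show "card {y \<in> Y. \<not> r x y} + 3 \<le> card Y" if "x \<in> X" for x
  proof -
    have "{y \<in> Y. \<not> r x y} = {}" using assms that by auto
    then show ?thesis using assms by (simp only: card.empty)
  qed
  show "card {x \<in> X. \<not> r x y} + 3 \<le> card X" if "y \<in> Y" for y
  proof -
    have "{x \<in> X. \<not> r x y} = {}" using assms that by auto
    then show ?thesis using assms by (simp only: card.empty)
  qed
qed (use assms in auto)

lemma conn3_insert:
  assumes "symp r" "conn3 r H" "v \<notin> H" "3 \<le> card {x \<in> H. r v x}"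
  shows "conn3 r (insert v H)"
  unfolding conn3_def
proof (intro conjI notI)
  have fH: "finite H" and cH: "4 \<le> card H" and nos: "\<And>P Q S. \<not> sep r H P Q S"
    using assms(2) by (auto simp: conn3_def)
  show "finite (insert v H)" "4 \<le> card (insert v H)" using fH cH assms(3) by auto
  assume "\<exists>P Q S. sep r (insert v H) P Q S"
  then obtain P Q S where s: "sep r (insert v H) P Q S" by blast
  have card_le: "card (S - {v}) \<le> 2"
    using s card_Diff1_le[of S v] unfolding sep_def by linarith
  have key: False if s: "sep r (insert v H) P Q S" and v: "v \<in> P" for P Q S
  proof (cases "P = {v}")
    case False
    then have "sep r H (P - {v}) Q S"
      using s v assms(3) unfolding sep_def by auto
    then show False using nos by blast
  next
    case True
    have "finite S" using s fH unfolding sep_def by (metis finite_Un finite_insert)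
    moreover have "{x \<in> H. r v x} \<subseteq> S"
      using s True assms(3) unfolding sep_def by auto
    ultimately have "card {x \<in> H. r v x} \<le> card S" by (simp add: card_mono)
    then show False using s assms(4) unfolding sep_def by auto
  qed
  have "v \<in> P \<or> v \<in> Q \<or> v \<in> S" using s unfolding sep_def by auto
  moreover have False if "v \<in> S"
  proof -
    have "sep r H P Q (S - {v})"
      using s that assms(3) card_le unfolding sep_def by auto
    then show False using nos by blast
  qed
  ultimately show False using key[OF s] key[OF sep_swap[OF assms(1) s]] by blast
qed

lemma conn3_two_dominating:
  assumes "symp r" "finite P" "finite Q" "P \<noteq> {}" "Q \<noteq> {}" "P \<inter> Q = {}"
    and "u \<noteq> v" "u \<notin> P \<union> Q" "v \<notin> P \<union> Q" and card: "3 \<le> card (P \<union> Q)"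
    and PQ: "\<And>p q. p \<in> P \<Longrightarrow> q \<in> Q \<Longrightarrow> r p q"
    and uv: "\<And>t. t \<in> P \<union> Q \<Longrightarrow> r u t \<and> r v t"
  shows "conn3 r ({u, v} \<union> (P \<union> Q))"
  unfolding conn3_def
proof (intro conjI notI)
  let ?T = "P \<union> Q"
  have fT: "finite ?T" using assms by simp
  have "card ({u, v} \<union> ?T) = card {u, v} + card ?T"
    using assms by (intro card_Un_disjoint) auto
  then show "4 \<le> card ({u, v} \<union> ?T)" using card \<open>u \<noteq> v\<close> by simp
  show "finite ({u, v} \<union> ?T)" using assms by simp
  assume "\<exists>A B S. sep r ({u, v} \<union> ?T) A B S"
  then obtain A B S where s: "sep r ({u, v} \<union> ?T) A B S" by blast
  have uvS: "a \<in> S" if "a \<in> {u, v}" "b \<in> {u, v}" "a \<noteq> b" for a b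
  proof -
    have key: False if s: "sep r ({u, v} \<union> ?T) A B S" and a: "a \<in> A" for A B S
    proof -
      have "r a t" if "t \<in> ?T" for t using uv that \<open>a \<in> {u, v}\<close> by auto
      then have "B \<inter> ?T = {}" using s a unfolding sep_def by blast
      then have "b \<in> B" using s a \<open>a \<noteq> b\<close> \<open>b \<in> {u, v}\<close> \<open>a \<in> {u, v}\<close> unfolding sep_def by auto
      moreover have "r t b" if "t \<in> ?T" for t
        using uv that \<open>b \<in> {u, v}\<close> assms(1) by (metis insertE singletonD sympD)
      ultimately have "A \<inter> ?T = {}" using s unfolding sep_def by blast
      then have "?T \<subseteq> S" using s \<open>B \<inter> ?T = {}\<close> unfolding sep_def by auto
      moreover have "finite S" using s fT unfolding sep_def
        by (metis finite.emptyI finite_Un finite_insert)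
      ultimately have "card ?T \<le> card S" by (simp add: card_mono)
      then show False using s card unfolding sep_def by linarith
    qed
    have "a \<in> A \<or> a \<in> B \<or> a \<in> S" using s that unfolding sep_def by auto
    then show ?thesis using key[OF s] key[OF sep_swap[OF assms(1) s]] by blast
  qed
  have "finite S" using s fT unfolding sep_def
    by (metis finite.emptyI finite_Un finite_insert)
  moreover have "{u, v} \<subseteq> S" using uvS[of u v] uvS[of v u] \<open>u \<noteq> v\<close> by auto
  moreover have "card S \<le> card {u, v}" using s \<open>u \<noteq> v\<close> unfolding sep_def by simp
  ultimately have S: "S = {u, v}" by (metis card_seteq)
  have AB: "A \<union> B = ?T" "A \<noteq> {}" "B \<noteq> {}" "\<And>a b. a \<in> A \<Longrightarrow> b \<in> B \<Longrightarrow> \<not> r a b"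
    using s S assms(8,9) unfolding sep_def by auto
  have QP: "r q p" if "p \<in> P" "q \<in> Q" for p q using PQ that assms(1) by (meson sympD)
  show False using AB PQ QP \<open>P \<noteq> {}\<close> \<open>Q \<noteq> {}\<close> by (metis Un_iff ex_in_conv)
qed

lemma conn3_wheel:
  assumes "symp r" "finite T" "2 \<le> card T" "u \<noteq> v" "x \<noteq> u" "x \<noteq> v" "{x, u, v} \<inter> T = {}"
    and xuv: "r x u" "r x v" and xT: "\<And>t. t \<in> T \<Longrightarrow> r x t \<and> r u t \<and> r v t"
  shows "conn3 r ({x, u, v} \<union> T)"
  unfolding conn3_def
proof (intro conjI notI)
  have "card ({x, u, v} \<union> T) = card {x, u, v} + card T"
    using assms by (intro card_Un_disjoint) auto
  then show "4 \<le> card ({x, u, v} \<union> T)" using assms by simp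
  show "finite ({x, u, v} \<union> T)" using assms by simp
  assume "\<exists>A B S. sep r ({x, u, v} \<union> T) A B S"
  then obtain A B S where s: "sep r ({x, u, v} \<union> T) A B S" by blast
  have x: False if s: "sep r ({x, u, v} \<union> T) A B S" and "x \<in> A" for A B S
  proof -
    obtain b where "b \<in> B" using s unfolding sep_def by blast
    moreover have "r x b" using s \<open>x \<in> A\<close> \<open>b \<in> B\<close> xuv xT unfolding sep_def by blast
    ultimately show False using s \<open>x \<in> A\<close> unfolding sep_def by blast
  qed
  have fS: "finite S" using s assms(2) unfolding sep_def
    by (metis finite.emptyI finite_Un finite_insert)
  have "x \<in> A \<or> x \<in> B \<or> x \<in> S" using s unfolding sep_def by auto
  then have "x \<in> S" using x[OF s] x[OF sep_swap[OF assms(1) s]] by blast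
  then have "card (S - {x}) \<le> 1" using s fS unfolding sep_def by auto
  then have S1: "a = b" if "a \<in> S" "b \<in> S" "a \<noteq> x" "b \<noteq> x" for a b
    using that fS by (metis card_le_Suc0_iff_eq finite_Diff One_nat_def Diff_iff singletonD)
  obtain t1 t2 where t: "t1 \<in> T" "t2 \<in> T" "t1 \<noteq> t2"
    using assms(2,3) by (metis card_le_Suc0_iff_eq not_less_eq_eq numeral_2_eq_2)
  have sy: "r a b \<Longrightarrow> r b a" for a b using assms(1) by (meson sympD)
  have AB: "A \<union> B \<union> S = {x, u, v} \<union> T" "A \<inter> B = {}" "A \<inter> S = {}" "B \<inter> S = {}"
     "A \<noteq> {}" "B \<noteq> {}" "\<And>a b. a \<in> A \<Longrightarrow> b \<in> B \<Longrightarrow> \<not> r a b"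
    using s unfolding sep_def by blast+
  have T: False if "sep r ({x, u, v} \<union> T) A B S" "w \<in> A" "w \<in> {u, v}" "T \<inter> S = {}" for A B w
  proof -
    have AB: "A \<union> B \<union> S = {x, u, v} \<union> T" "A \<inter> B = {}" "B \<inter> S = {}" "B \<noteq> {}"
      and no: "\<And>a b. a \<in> A \<Longrightarrow> b \<in> B \<Longrightarrow> \<not> r a b"
      using that(1) unfolding sep_def by blast+
    have TA: "t \<in> A" if "t \<in> T" for t
    proof -
      have "r w t" using xT[OF that] \<open>w \<in> {u, v}\<close> by blast
      then have "t \<notin> B" using no[OF \<open>w \<in> A\<close>] by blast
      then show ?thesis using AB(1) that \<open>T \<inter> S = {}\<close> by blast
    qed
    have "r t1 u" "r t1 v" using xT[OF t(1)] sy by auto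
    then have "u \<notin> B" "v \<notin> B" using no[OF TA[OF t(1)]] by auto
    moreover have "x \<notin> B" using \<open>x \<in> S\<close> AB(3) by blast
    moreover have "B \<inter> T = {}" using TA AB(2) by blast
    ultimately show False using AB by blast
  qed
  have uv: False if "sep r ({x, u, v} \<union> T) A B S" "w \<in> A" "w \<in> T" "u \<notin> S" "v \<notin> S" for A B w
  proof -
    have AB: "A \<union> B \<union> S = {x, u, v} \<union> T" "A \<inter> B = {}" "B \<inter> S = {}" "B \<noteq> {}"
      and no: "\<And>a b. a \<in> A \<Longrightarrow> b \<in> B \<Longrightarrow> \<not> r a b"
      using that(1) unfolding sep_def by blast+
    have "r w u" "r w v" using xT[OF that(3)] sy by auto
    then have "u \<notin> B" "v \<notin> B" using no[OF that(2)] by auto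
    moreover from this have "u \<in> A" using AB(1) that(4) by blast
    then have "B \<inter> T = {}" using no xT by blast
    moreover have "x \<notin> B" using \<open>x \<in> S\<close> AB(3) by blast
    ultimately show False using AB by blast
  qed
  have AB: "w \<in> A \<or> w \<in> B" if "w \<notin> S" "w \<in> {x, u, v} \<union> T" for w
    using s that unfolding sep_def by blast
  note s' = sep_swap[OF assms(1) s]
  show False
  proof (cases "T \<inter> S = {}")
    case True
    have "u \<notin> S \<or> v \<notin> S" using S1[of u v] assms(4-6) by blast
    then obtain w where w: "w \<in> {u, v}" "w \<notin> S" by blast
    then show False using AB[of w] T[OF s _ w(1) True] T[OF s' _ w(1) True] by blast
  next
    case False
    then obtain z where z: "z \<in> T" "z \<in> S" by blast
    then have uvS: "u \<notin> S" "v \<notin> S" using S1[of z u] S1[of z v] assms(5-7) by blast+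
    have "t1 \<notin> S \<or> t2 \<notin> S" using S1[of t1 t2] t assms(7) by blast
    then obtain w where w: "w \<in> T" "w \<notin> S" using t by blast
    then show False using AB[of w] uv[OF s _ w(1) uvS] uv[OF s' _ w(1) uvS] by blast
  qed
qed

section \<open>Colourings without large monochromatic 3-connected subgraphs\<close>

lemma symp_compl_rel: "symp r \<Longrightarrow> symp (\<lambda>x y. \<not> r x y)"
  by (simp add: symp_def) blast

definition nbrs :: "('a \<Rightarrow> 'a \<Rightarrow> bool) \<Rightarrow> 'a set \<Rightarrow> 'a \<Rightarrow> 'a set" where
  "nbrs r U x = {y \<in> U. y \<noteq> x \<and> r x y}"

text \<open>Counts ordered pairs, hence every edge twice.\<close>

definition ecount :: "('a \<Rightarrow> 'a \<Rightarrow> bool) \<Rightarrow> 'a set \<Rightarrow> nat" where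
  "ecount r U = card {(x, y). x \<in> U \<and> y \<in> U \<and> x \<noteq> y \<and> r x y}"

lemma finite_pairs: "finite U \<Longrightarrow> finite {(x, y). x \<in> U \<and> y \<in> U \<and> R x y}"
  by (rule finite_subset[of _ "U \<times> U"]) auto

lemma ecount_compl:
  assumes "finite U"
  shows "ecount r U + ecount (\<lambda>x y. \<not> r x y) U = card U * (card U - 1)"
proof -
  let ?A = "\<lambda>r. {(x, y). x \<in> U \<and> y \<in> U \<and> x \<noteq> y \<and> r x y}"
  have "card (?A r) + card (?A (\<lambda>x y. \<not> r x y)) = card (?A r \<union> ?A (\<lambda>x y. \<not> r x y))"
    using finite_pairs[OF assms] by (intro card_Un_disjoint[symmetric]) auto
  also have "?A r \<union> ?A (\<lambda>x y. \<not> r x y) = (SIGMA x:U. U - {x})" by auto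
  also have "card \<dots> = card U * (card U - 1)" using assms by simp
  finally show ?thesis by (simp add: ecount_def)
qed

lemma ecount_remove:
  assumes "symp r" "finite U" "x \<in> U"
  shows "ecount r U = ecount r (U - {x}) + 2 * card (nbrs r U x)"
proof -
  let ?A = "\<lambda>U. {(x, y). x \<in> U \<and> y \<in> U \<and> x \<noteq> y \<and> r x y}"
  let ?N = "nbrs r U x"
  have fN: "finite ?N" using assms(2) by (simp add: nbrs_def)
  have "?A U = ?A (U - {x}) \<union> ({x} \<times> ?N \<union> ?N \<times> {x})"
    using assms by (auto simp: nbrs_def dest: sympD)
  then have "card (?A U) = card (?A (U - {x}) \<union> ({x} \<times> ?N \<union> ?N \<times> {x}))" by (rule arg_cong)
  also have "\<dots> = card (?A (U - {x})) + card ({x} \<times> ?N \<union> ?N \<times> {x})"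
    using fN finite_pairs[of "U - {x}"] assms(2) by (intro card_Un_disjoint) auto
  also have "card ({x} \<times> ?N \<union> ?N \<times> {x}) = card ({x} \<times> ?N) + card (?N \<times> {x})"
    using fN by (intro card_Un_disjoint) (auto simp: nbrs_def)
  finally show ?thesis by (simp add: ecount_def card_cartesian_product)
qed

locale no_large_conn3 =
  fixes r :: "'a \<Rightarrow> 'a \<Rightarrow> bool" and V :: "'a set"
  assumes symp: "symp r" and fin: "finite V" and card_V: "9 \<le> card V"
    and no: "\<And>U. U \<subseteq> V \<Longrightarrow> card V \<le> card U + 4 \<Longrightarrow> \<not> conn3 r U"
    and no_compl: "\<And>U. U \<subseteq> V \<Longrightarrow> card V \<le> card U + 4 \<Longrightarrow> \<not> conn3 (\<lambda>x y. \<not> r x y) U"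
begin

lemma flip: "no_large_conn3 (\<lambda>x y. \<not> r x y) V"
  using no_large_conn3_axioms by (simp add: no_large_conn3_def symp_compl_rel)

lemma symp_compl: "symp (\<lambda>x y. \<not> r x y)"
  using symp by (rule symp_compl_rel)

lemma no_dominating_pair:
  assumes "u \<in> V" "v \<in> V" "u \<noteq> v" "T \<subseteq> V - {u, v}" "card V \<le> card T + 4"
    and uv: "\<And>t. t \<in> T \<Longrightarrow> r u t \<and> r v t"
  shows False
proof -
  have T: "T \<subseteq> V" using assms by auto
  then have fT: "finite T" using fin by (rule finite_subset)
  have "4 \<le> card T" using assms(5) card_V by simp
  then obtain P Q S where s: "P \<union> Q \<union> S = T" "P \<inter> Q = {}" "P \<noteq> {}" "Q \<noteq> {}" "card S = 2"
      "\<And>p q. p \<in> P \<Longrightarrow> q \<in> Q \<Longrightarrow> \<not> \<not> r p q" "card T = card P + card Q + 2" "finite P" "finite Q"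
    using not_conn3E[OF no_compl[OF T assms(5)] symp_compl fT] by metis
  have c: "card (P \<union> Q) = card P + card Q" using s by (simp add: card_Un_disjoint)
  have "conn3 r ({u, v} \<union> (P \<union> Q))"
  proof (rule conn3_two_dominating)
    show "3 \<le> card (P \<union> Q)" using c s assms(5) card_V by linarith
  qed (use symp s assms in auto)
  moreover have "card ({u, v} \<union> (P \<union> Q)) = card {u, v} + card (P \<union> Q)"
    using s assms by (intro card_Un_disjoint) auto
  moreover have "{u, v} \<union> (P \<union> Q) \<subseteq> V" using s assms by auto
  ultimately show False using no[of "{u, v} \<union> (P \<union> Q)"] c s assms(3,5) by simp
qed

lemma cut:
  assumes "U \<subseteq> V" "card V \<le> card U + 4"
  obtains P Q S where "P \<union> Q \<union> S = U" "P \<inter> Q = {}" "P \<inter> S = {}" "Q \<inter> S = {}"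
    "card S = 2" "\<And>p q. p \<in> P \<Longrightarrow> q \<in> Q \<Longrightarrow> \<not> r p q" "card U = card P + card Q + 2"
    "finite P" "finite Q" "finite S"
    "card P = 1 \<or> card P = 2 \<or> 3 \<le> card P \<and> 3 \<le> card Q \<and> card U + 2 < card V"
proof -
  have U: "finite U" "4 \<le> card U" using assms fin card_V by (auto intro: finite_subset)
  obtain P Q S where s: "P \<union> Q \<union> S = U" "P \<inter> Q = {}" "P \<inter> S = {}" "Q \<inter> S = {}"
    "P \<noteq> {}" "Q \<noteq> {}" "card S = 2" "card P \<le> card Q" "\<And>p q. p \<in> P \<Longrightarrow> q \<in> Q \<Longrightarrow> \<not> r p q"
    "card U = card P + card Q + 2" "finite P" "finite Q" "finite S"
    using not_conn3E[OF no[OF assms] symp U] by blast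
  have "card U + 2 < card V" if "3 \<le> card P"
  proof (rule ccontr)
    assume a: "\<not> card U + 2 < card V"
    have "conn3 (\<lambda>x y. \<not> r x y) (P \<union> Q)"
      by (rule conn3_complete_bipartite) (use symp_compl s that in auto)
    moreover have "card (P \<union> Q) = card P + card Q" using s by (simp add: card_Un_disjoint)
    ultimately show False using no_compl[of "P \<union> Q"] s assms a by auto
  qed
  moreover have "card P \<noteq> 0" using s by auto
  ultimately have "card P = 1 \<or> card P = 2 \<or> 3 \<le> card P \<and> 3 \<le> card Q \<and> card U + 2 < card V"
    using s(8) by linarith
  with that s show thesis by metis
qed

lemma low_degree_vertex: "\<exists>x\<in>V. card (nbrs r V x) \<le> 2"
proof -
  obtain P Q S where s: "P \<union> Q \<union> S = V" "P \<inter> Q = {}" "card S = 2"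
    "\<And>p q. p \<in> P \<Longrightarrow> q \<in> Q \<Longrightarrow> \<not> r p q" "card V = card P + card Q + 2" "finite S"
    "card P = 1 \<or> card P = 2"
    using cut[of V] by (metis order_refl le_add1 not_add_less1)
  from s(7) show ?thesis
  proof
    assume "card P = 1"
    then obtain x where x: "P = {x}" by (meson card_1_singletonE)
    then have "nbrs r V x \<subseteq> S" using s by (auto simp: nbrs_def)
    then have "card (nbrs r V x) \<le> 2" using s card_mono by metis
    then show ?thesis using x s by blast
  next
    assume "card P = 2"
    then obtain u v where uv: "P = {u, v}" "u \<noteq> v" by (meson card_2_iff)
    interpret B: no_large_conn3 "\<lambda>x y. \<not> r x y" V by (rule flip)
    have False by (rule B.no_dominating_pair[of u v Q]) (use s uv in auto)
    then show ?thesis ..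
  qed
qed

lemma second_low_degree_vertex:
  assumes x: "x \<in> V" "card (nbrs r V x) \<le> 2"
  shows "\<exists>y\<in>V - {x}. card (nbrs r (V - {x}) y) \<le> 2"
proof -
  have cU: "card (V - {x}) + 1 = card V" using x fin card_V by simp
  define U where "U = V - {x}"
  have U: "U \<subseteq> V" "card V \<le> card U + 4" using cU by (auto simp: U_def)
  obtain P Q S where s': "P \<union> Q \<union> S = U" "P \<inter> Q = {}" "P \<inter> S = {}" "Q \<inter> S = {}"
    "card S = 2" "\<And>p q. p \<in> P \<Longrightarrow> q \<in> Q \<Longrightarrow> \<not> r p q" "card U = card P + card Q + 2"
    "finite P" "finite Q" "finite S"
    "card P = 1 \<or> card P = 2 \<or> 3 \<le> card P \<and> 3 \<le> card Q \<and> card U + 2 < card V"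
    using cut[OF U] by blast
  note s = s'(1,2,5,6,7,10,9,11)[unfolded U_def]
  from s(8) have "card P = 1 \<or> card P = 2" using cU by linarith
  then show ?thesis
  proof
    assume "card P = 1"
    then obtain y where y: "P = {y}" by (meson card_1_singletonE)
    then have "nbrs r (V - {x}) y \<subseteq> S" using s by (auto simp: nbrs_def)
    then have "card (nbrs r (V - {x}) y) \<le> 2" using s card_mono by metis
    then show ?thesis using y s by blast
  next
    assume "card P = 2"
    then obtain u v where uv: "P = {u, v}" "u \<noteq> v" by (meson card_2_iff)
    let ?N = "nbrs r V x"
    let ?T = "Q - ?N"
    have fN: "finite ?N" using fin by (simp add: nbrs_def)
    have "card Q \<le> card ?T + card (Q \<inter> ?N)"
      using s(7) by (metis Diff_disjoint Int_Diff_Un add.commute card_Un_le)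
    moreover have "card Q + 5 = card V" using s cU uv by simp
    ultimately have T: "card V \<le> card ?T + card (Q \<inter> ?N) + 5" by simp
    have xs: "x \<noteq> u" "x \<noteq> v" "{x, u, v} \<inter> ?T = {}" "{x, u, v} \<union> ?T \<subseteq> V" 
      using s uv x by auto
    have xT: "\<not> r x t \<and> \<not> r u t \<and> \<not> r v t" if "t \<in> ?T" for t
      using that s uv x by (auto simp: nbrs_def)
    have QN: "card (Q \<inter> ?N) \<le> card ?N" using fN by (simp add: card_mono)
    have "card ({x, u, v} \<union> ?T) = card {x, u, v} + card ?T"
      using s xs by (intro card_Un_disjoint) auto
    then have c: "card ({x, u, v} \<union> ?T) = 3 + card ?T" using xs uv by simp
    have "conn3 (\<lambda>x y. \<not> r x y) ({x, u, v} \<union> ?T)"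
    proof (cases "Q \<inter> ?N = ?N \<and> card ?N = 2")
      case True
      then have "u \<notin> ?N" "v \<notin> ?N" using s uv by auto
      then have "\<not> r x u" "\<not> r x v" using s uv xs by (auto simp: nbrs_def)
      then show ?thesis using xT xs uv s T card_V True
        by (intro conn3_wheel) (auto simp: symp_compl)
    next
      case False
      have "card (Q \<inter> ?N) \<le> 1"
      proof (rule ccontr)
        assume "\<not> ?thesis"
        then have "card ?N = 2" "card (Q \<inter> ?N) = card ?N" using QN x(2) by linarith+
        moreover then have "Q \<inter> ?N = ?N" using fN by (simp add: card_subset_eq)
        ultimately show False using False by blast
      qed
      then have "3 \<le> card ?T" using T card_V by linarith
      then show ?thesis using xT xs uv s symp_compl
        by (intro conn3_complete_bipartite) auto
    qed
    then have False using no_compl[OF xs(4)] T c QN x(2) by simp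
    then show ?thesis ..
  qed
qed

text \<open>Removing the small side of a cut of \<open>U\<close> loses at most 2 edges if that side is one vertex
  and at most 5 if it is two; otherwise the complement contains a \<open>K\<^sub>3\<^sub>,\<^sub>3\<close>.\<close>

lemma count_step:
  assumes "U \<subseteq> V" "card V \<le> card U + 4"
  obtains U' where "U' \<subseteq> U" "card U = card U' + 1" "ecount r U \<le> ecount r U' + 4"
  | U' where "U' \<subseteq> U" "card U = card U' + 2" "ecount r U \<le> ecount r U' + 10"
  | "8 \<le> card U" "card U + 2 < card V" "ecount r U + 18 \<le> card U * (card U - 1)"
proof -
  have fU: "finite U" using assms fin finite_subset by blast
  obtain P Q S where s: "P \<union> Q \<union> S = U" "P \<inter> Q = {}" "P \<inter> S = {}" "Q \<inter> S = {}"
    "card S = 2" "\<And>p q. p \<in> P \<Longrightarrow> q \<in> Q \<Longrightarrow> \<not> r p q" "card U = card P + card Q + 2"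
    "finite P" "finite Q" "finite S"
    "card P = 1 \<or> card P = 2 \<or> 3 \<le> card P \<and> 3 \<le> card Q \<and> card U + 2 < card V"
    using cut[OF assms] by blast
  from s(11) show thesis
  proof (elim disjE conjE)
    assume "card P = 1"
    then obtain x where x: "P = {x}" by (meson card_1_singletonE)
    have "nbrs r U x \<subseteq> S" using s x by (auto simp: nbrs_def)
    then have "card (nbrs r U x) \<le> 2" using s card_mono by metis
    moreover have "x \<in> U" using s x by auto
    moreover from this have "card U = card (U - {x}) + 1"
      using fU by (metis card_Suc_Diff1 Suc_eq_plus1)
    ultimately show thesis using ecount_remove[OF symp fU] that(1)[of "U - {x}"] by auto
  next
    assume "card P = 2"
    then obtain u v where uv: "P = {u, v}" "u \<noteq> v" by (meson card_2_iff)
    have "nbrs r U u \<subseteq> insert v S" using s uv by (auto simp: nbrs_def)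
    then have "card (nbrs r U u) \<le> card (insert v S)" using s by (intro card_mono) auto
    also have "\<dots> \<le> 3" using s by (simp add: card_insert_if)
    finally have u: "card (nbrs r U u) \<le> 3" .
    have "nbrs r (U - {u}) v \<subseteq> S" using s uv by (auto simp: nbrs_def)
    then have v: "card (nbrs r (U - {u}) v) \<le> 2" using s card_mono by metis
    have "u \<in> U" "v \<in> U - {u}" using s uv by auto
    then have "ecount r U = ecount r (U - {u} - {v}) + 2 * card (nbrs r (U - {u}) v)
        + 2 * card (nbrs r U u)" 
      using ecount_remove[OF symp fU] ecount_remove[OF symp, of "U - {u}" v] fU by simp
    moreover have "card U = card (U - {u} - {v}) + 2"
      using fU \<open>u \<in> U\<close> \<open>v \<in> U - {u}\<close>
      by (metis card_Suc_Diff1 add_2_eq_Suc' finite_Diff)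
    ultimately show thesis using u v that(2)[of "U - {u} - {v}"] by auto
  next
    assume a: "3 \<le> card P" "3 \<le> card Q" "card U + 2 < card V"
    let ?B = "{(x, y). x \<in> U \<and> y \<in> U \<and> x \<noteq> y \<and> \<not> r x y}"
    have "P \<times> Q \<union> Q \<times> P \<subseteq> ?B" using s symp by (auto dest: sympD)
    then have "card (P \<times> Q \<union> Q \<times> P) \<le> card ?B"
      using finite_pairs[OF fU] by (intro card_mono) auto
    moreover have "card (P \<times> Q \<union> Q \<times> P) = card P * card Q + card Q * card P"
      using s by (subst card_Un_disjoint) (auto simp: card_cartesian_product)
    moreover have "3 * 3 \<le> card P * card Q" using a mult_le_mono by blast
    ultimately have "18 \<le> card ?B" by (simp add: mult.commute)
    then have "ecount r U + 18 \<le> card U * (card U - 1)"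
      using ecount_compl[OF fU, of r] by (simp add: ecount_def)
    then show thesis using that(3) a s by simp
  qed
qed

definition bounded_at :: "nat \<Rightarrow> nat \<Rightarrow> bool" where
  "bounded_at m b \<longleftrightarrow> (\<forall>U\<subseteq>V. card U = m \<longrightarrow> ecount r U \<le> b)"

lemma bounded_at_trivial: "m * (m - 1) \<le> b \<Longrightarrow> bounded_at m b"
  unfolding bounded_at_def
proof (intro allI impI)
  fix U assume "m * (m - 1) \<le> b" "U \<subseteq> V" "card U = m"
  moreover from this have "finite U" using fin finite_subset by blast
  ultimately show "ecount r U \<le> b" using ecount_compl[of U r] by simp
qed

lemma bounded_at_step:
  assumes "bounded_at m b1" "bounded_at (m + 1) b2" "card V \<le> m + 6"
    and "8 \<le> m + 2 \<Longrightarrow> m + 4 < card V \<Longrightarrow> (m + 2) * (m + 1) \<le> b + 18"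
    and "b1 + 10 \<le> b" "b2 + 4 \<le> b"
  shows "bounded_at (m + 2) b"
  unfolding bounded_at_def
proof (intro allI impI)
  fix U assume U: "U \<subseteq> V" "card U = m + 2"
  then have *: "card V \<le> card U + 4" using assms(3) by simp
  show "ecount r U \<le> b"
  proof (cases rule: count_step[OF U(1) *])
    case (1 U')
    then have "ecount r U' \<le> b2" using assms(2) U unfolding bounded_at_def by auto
    then show ?thesis using 1 assms by simp
  next
    case (2 U')
    then have "ecount r U' \<le> b1" using assms(1) U unfolding bounded_at_def by auto
    then show ?thesis using 2 assms by simp
  next
    case 3
    then show ?thesis using assms(4) U by simp
  qed
qed

lemma ecount_small:
  "card V = 9 \<Longrightarrow> ecount r V \<le> 34"
  "card V = 10 \<Longrightarrow> ecount r V \<le> 44"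
  "card V = 11 \<Longrightarrow> ecount r V \<le> 54"
proof -
  assume n: "card V = 9"
  have b: "bounded_at 3 6" "bounded_at 4 12" by (rule bounded_at_trivial; simp)+
  have b5: "bounded_at 5 16" using bounded_at_step[of 3 6 12 16] b n by simp
  have b6: "bounded_at 6 22" using bounded_at_step[of 4 12 16 22] b b5 n by simp
  have b7: "bounded_at 7 26" using bounded_at_step[of 5 16 22 26] b5 b6 n by simp
  obtain x where x: "x \<in> V" "card (nbrs r V x) \<le> 2" using low_degree_vertex by blast
  then obtain y where y: "y \<in> V - {x}" "card (nbrs r (V - {x}) y) \<le> 2"
    using second_low_degree_vertex by blast
  have "card (V - {x} - {y}) = 7" using x y n fin by simp
  moreover have "V - {x} - {y} \<subseteq> V" by blast
  ultimately have "ecount r (V - {x} - {y}) \<le> 26"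
    using b7 unfolding bounded_at_def by simp
  then show "ecount r V \<le> 34"
    using ecount_remove[OF symp fin x(1)] ecount_remove[OF symp _ y(1)] fin x y by simp
next
  assume n: "card V = 10"
  have b: "bounded_at 4 12" "bounded_at 5 20" by (rule bounded_at_trivial; simp)+
  have b6: "bounded_at 6 24" using bounded_at_step[of 4 12 20 24] b n by simp
  have b7: "bounded_at 7 30" using bounded_at_step[of 5 20 24 30] b b6 n by simp
  have b8: "bounded_at 8 34" using bounded_at_step[of 6 24 30 34] b6 b7 n by simp
  have b9: "bounded_at 9 40" using bounded_at_step[of 7 30 34 40] b7 b8 n by simp
  have "bounded_at 10 44" using bounded_at_step[of 8 34 40 44] b8 b9 n by simp
  then show "ecount r V \<le> 44" using n by (simp add: bounded_at_def)
next
  assume n: "card V = 11"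
  have b: "bounded_at 5 20" "bounded_at 6 30" by (rule bounded_at_trivial; simp)+
  have b7: "bounded_at 7 34" using bounded_at_step[of 5 20 30 34] b n by simp
  have b8: "bounded_at 8 40" using bounded_at_step[of 6 30 34 40] b b7 n by simp
  have b9: "bounded_at 9 44" using bounded_at_step[of 7 34 40 44] b7 b8 n by simp
  have b10: "bounded_at 10 50" using bounded_at_step[of 8 40 44 50] b8 b9 n by simp
  have "bounded_at 11 54" using bounded_at_step[of 9 44 50 54] b9 b10 n by simp
  then show "ecount r V \<le> 54" using n by (simp add: bounded_at_def)
qed

lemma card_V_ge_12: "12 \<le> card V"
proof (rule ccontr)
  assume "\<not> 12 \<le> card V"
  then consider "card V = 9" | "card V = 10" | "card V = 11" using card_V by linarith
  then show False
    using ecount_small no_large_conn3.ecount_small[OF flip] ecount_compl[OF fin, of r]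
    by cases fastforce+
qed


lemma no_conn3_minus_five:
  assumes H: "H \<subseteq> V" "card V \<le> card H + 5" and conn: "conn3 r H"
  shows False
proof -
  interpret B: no_large_conn3 "\<lambda>x y. \<not> r x y" V by (rule flip)
  define W where "W = V - H"
  have fH: "finite H" "finite W" using H fin finite_subset by (auto simp: W_def)
  have V12: "12 \<le> card V" by (rule card_V_ge_12)
  have cH: "card V = card H + 5" using no[OF H(1)] conn H(2) by linarith
  have cW: "card W = 5" using cH H fH by (simp add: W_def card_Diff_subset)
  have sy: "r a b \<Longrightarrow> r b a" for a b using symp by (meson sympD)
  have w2: "card {x \<in> H. r w x} \<le> 2" if "w \<in> W" for w
  proof (rule ccontr)
    assume "\<not> ?thesis"
    then have "conn3 r (insert w H)"
      using that by (intro conn3_insert symp conn) (auto simp: W_def)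
    moreover have "card (insert w H) = card H + 1" using that fH by (simp add: W_def)
    ultimately show False using no[of "insert w H"] that H cH by (simp add: W_def)
  qed
  have wB: "card H \<le> card {x \<in> H. \<not> r w x} + 2" if "w \<in> W" for w
  proof -
    have "card H = card ({x \<in> H. \<not> r w x} \<union> {x \<in> H. r w x})"
      by (rule arg_cong[where f = card]) blast
    then show ?thesis using w2[OF that] card_Un_le[of "{x \<in> H. \<not> r w x}" "{x \<in> H. r w x}"] by simp
  qed
  obtain y1 where y1: "y1 \<in> V" "card (nbrs (\<lambda>x y. \<not> r x y) V y1) \<le> 2"
    using B.low_degree_vertex by blast
  then obtain y2 where y2: "y2 \<in> V - {y1}" "card (nbrs (\<lambda>x y. \<not> r x y) (V - {y1}) y2) \<le> 2"
    using B.second_low_degree_vertex by blast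
  have low: "y \<in> H \<and> 3 \<le> card {w \<in> W. r w y}"
    if y: "y \<in> V" "card (nbrs (\<lambda>x y. \<not> r x y) U y) \<le> 2" and U: "V - U \<subseteq> {z}" "z \<in> V \<Longrightarrow> z \<in> H \<or> z \<in> U" "U \<subseteq> V" for y U z
  proof
    let ?N = "nbrs (\<lambda>x y. \<not> r x y) U y"
    have fN: "finite ?N" using fin U(3) by (auto simp: nbrs_def intro: finite_subset)
    show yH: "y \<in> H"
    proof (rule ccontr)
      assume "y \<notin> H"
      then have yW: "y \<in> W" using y by (simp add: W_def)
      have "{x \<in> H. \<not> r y x} \<subseteq> insert z ?N"
        using \<open>y \<notin> H\<close> H U by (auto simp: nbrs_def)
      then have "card {x \<in> H. \<not> r y x} \<le> card (insert z ?N)" using fN by (intro card_mono) auto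
      also have "\<dots> \<le> 3" using y fN by (simp add: card_insert_if)
      finally show False using wB[OF yW] cH V12 by simp
    qed
    have "{w \<in> W. \<not> r w y} \<subseteq> ?N" using yH U sy by (auto simp: nbrs_def W_def)
    then have "card {w \<in> W. \<not> r w y} \<le> 2" using fN y by (meson card_mono order_trans)
    moreover have "card W = card ({w \<in> W. \<not> r w y} \<union> {w \<in> W. r w y})"
      by (rule arg_cong[where f = card]) blast
    ultimately show "3 \<le> card {w \<in> W. r w y}"
      using cW card_Un_le[of "{w \<in> W. \<not> r w y}" "{w \<in> W. r w y}"] by simp
  qed
  have y1': "y1 \<in> H" "3 \<le> card {w \<in> W. r w y1}"
    using low[of y1 V y1] y1 by auto
  have y2': "y2 \<in> H" "3 \<le> card {w \<in> W. r w y2}"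
    using low[of y2 "V - {y1}" y1] y2 y1' by auto
  define H' where "H' = H - {y1, y2}"
  have fH': "finite H'" using fH by (simp add: H'_def)
  have "card {y1, y2} = 2" using y2 by auto
  then have cH': "card H' + 7 = card V"
    using y1' y2' cH fH V12 by (simp add: H'_def card_Diff_subset)
  have disj: "W \<inter> H' = {}" by (auto simp: W_def H'_def)
  have sub: "W \<union> H' \<subseteq> V" using H by (auto simp: W_def H'_def)
  have fM: "finite {(w, h). w \<in> W \<and> h \<in> A \<and> r w h}" if "A \<subseteq> H" for A
    by (rule finite_subset[of _ "W \<times> H"]) (use fH that in auto)
  let ?M = "{(w, h). w \<in> W \<and> h \<in> H' \<and> r w h}"
  have M: "card ?M \<le> 4"
  proof -
    have "{(w, h). w \<in> W \<and> h \<in> H \<and> r w h} = (SIGMA w:W. {x \<in> H. r w x})" by auto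
    also have "card \<dots> = (\<Sum>w\<in>W. card {x \<in> H. r w x})" using fH by simp
    also have "\<dots> \<le> (\<Sum>w\<in>W. 2)" using w2 by (rule sum_mono)
    finally have "card {(w, h). w \<in> W \<and> h \<in> H \<and> r w h} \<le> 10" using cW by simp
    moreover have "card (?M \<union> ({w \<in> W. r w y1} \<times> {y1} \<union> {w \<in> W. r w y2} \<times> {y2}))
        \<le> card {(w, h). w \<in> W \<and> h \<in> H \<and> r w h}"
      by (rule card_mono) (use fM[of H] y1' y2' in \<open>auto simp: H'_def\<close>)
    moreover have "card (?M \<union> ({w \<in> W. r w y1} \<times> {y1} \<union> {w \<in> W. r w y2} \<times> {y2}))
        = card ?M + card ({w \<in> W. r w y1} \<times> {y1} \<union> {w \<in> W. r w y2} \<times> {y2})"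
      by (rule card_Un_disjoint) (use fM[of H'] fH in \<open>auto simp: H'_def\<close>)
    moreover have "card ({w \<in> W. r w y1} \<times> {y1} \<union> {w \<in> W. r w y2} \<times> {y2})
        = card ({w \<in> W. r w y1} \<times> {y1}) + card ({w \<in> W. r w y2} \<times> {y2})"
      by (rule card_Un_disjoint) (use fH y2 in auto)
    ultimately show ?thesis using y1' y2' by (simp add: card_cartesian_product)
  qed
  show False
  proof (cases "\<exists>v\<in>H'. 3 \<le> card {w \<in> W. r w v}")
    case True
    then obtain v where v: "v \<in> H'" "3 \<le> card {w \<in> W. r w v}" by blast
    let ?Y = "H' - {v}"
    let ?M' = "{(w, h). w \<in> W \<and> h \<in> ?Y \<and> r w h}"
    have fM': "finite ?M'" using fM[of ?Y] by (auto simp: H'_def)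
    have "?M' \<union> {w \<in> W. r w v} \<times> {v} \<subseteq> ?M" using v by auto
    then have "card (?M' \<union> {w \<in> W. r w v} \<times> {v}) \<le> card ?M"
      using fM[of H'] by (intro card_mono) (auto simp: H'_def)
    moreover have "card (?M' \<union> {w \<in> W. r w v} \<times> {v}) = card ?M' + card ({w \<in> W. r w v} \<times> {v})"
      by (rule card_Un_disjoint) (use fM' fH in auto)
    ultimately have M': "card ?M' \<le> 1" using M v by (simp add: card_cartesian_product)
    have cY: "card ?Y + 8 = card V" using cH' v fH' V12 by simp
    have "conn3 (\<lambda>x y. \<not> r x y) (W \<union> ?Y)"
    proof (rule conn3_bipartite)
      show "card {y \<in> ?Y. \<not> \<not> r x y} + 3 \<le> card ?Y" if "x \<in> W" for x
      proof -
        have "card ({x} \<times> {y \<in> ?Y. r x y}) \<le> card ?M'"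
          by (rule card_mono[OF fM']) (use that in auto)
        then show ?thesis using M' cY V12 by (simp add: card_cartesian_product)
      qed
      show "card {x \<in> W. \<not> \<not> r x y} + 3 \<le> card W" if "y \<in> ?Y" for y
      proof -
        have "card ({x \<in> W. r x y} \<times> {y}) \<le> card ?M'"
          by (rule card_mono[OF fM']) (use that in auto)
        then show ?thesis using M' cW by (simp add: card_cartesian_product)
      qed
      show "card {(x, y). x \<in> W \<and> y \<in> ?Y \<and> \<not> \<not> r x y} + 4 < card W + card ?Y"
        unfolding not_not using M' cW cY V12 by linarith
    qed (use fH fH' disj symp_compl in auto)
    moreover have "card (W \<union> ?Y) = card W + card ?Y"
      using fH fH' disj by (intro card_Un_disjoint) auto
    ultimately show False using no_compl[of "W \<union> ?Y"] sub cY cW by auto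
  next
    case False
    have "conn3 (\<lambda>x y. \<not> r x y) (W \<union> H')"
    proof (rule conn3_bipartite)
      show "card {y \<in> H'. \<not> \<not> r x y} + 3 \<le> card H'" if "x \<in> W" for x
      proof -
        have "card {y \<in> H'. r x y} \<le> card {y \<in> H. r x y}"
          by (rule card_mono) (use fH in \<open>auto simp: H'_def\<close>)
        then show ?thesis using w2[OF that] cH' V12 by simp
      qed
      show "card {x \<in> W. \<not> \<not> r x y} + 3 \<le> card W" if "y \<in> H'" for y
        using False that cW by force
      show "card {(x, y). x \<in> W \<and> y \<in> H' \<and> \<not> \<not> r x y} + 4 < card W + card H'"
        unfolding not_not using M cW cH' V12 by linarith
    qed (use fH fH' disj symp_compl in auto)
    moreover have "card (W \<union> H') = card W + card H'"
      using fH fH' disj by (intro card_Un_disjoint) auto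
    ultimately show False using no_compl[of "W \<union> H'"] sub cH' cW by auto
  qed
qed

end

theorem large_mono_conn3:
  assumes "symp r" "finite V" "9 \<le> card V"
  shows "\<exists>U\<subseteq>V. card V \<le> card U + 4 \<and> (conn3 r U \<or> conn3 (\<lambda>x y. \<not> r x y) U)"
  using assms(2,3)
proof (induction "card V" arbitrary: V rule: less_induct)
  case less
  show ?case
  proof (rule ccontr)
    assume none: "\<not> ?thesis"
    interpret no_large_conn3 r V
      by standard (use none less.prems assms(1) in auto)
    interpret B: no_large_conn3 "\<lambda>x y. \<not> r x y" V by (rule flip)
    have "12 \<le> card V" by (rule card_V_ge_12)
    then obtain v where v: "v \<in> V" by fastforce
    then have c: "card (V - {v}) + 1 = card V" using fin card_V by simp
    then obtain U where "U \<subseteq> V - {v}" "card (V - {v}) \<le> card U + 4"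
        "conn3 r U \<or> conn3 (\<lambda>x y. \<not> r x y) U"
      using less.hyps[of "V - {v}"] fin \<open>12 \<le> card V\<close> by auto
    then show False using no_conn3_minus_five[of U] B.no_conn3_minus_five[of U] c by auto
  qed
qed

section \<open>The extremal number\<close>

lemma k_connected_3I:
  assumes "conn3 r U" and F: "\<And>x y. x \<in> U \<Longrightarrow> y \<in> U \<Longrightarrow> x \<noteq> y \<Longrightarrow> r x y \<Longrightarrow> {x, y} \<in> F"
  shows "k_connected 3 (U, F)"
  unfolding k_connected_def
proof (intro conjI allI impI)
  have fU: "finite U" and cU: "4 \<le> card U" using assms(1) by (auto simp: conn3_def)
  show "finite (fst (U, F))" "3 + 1 \<le> card (fst (U, F))" using fU cU by auto
  fix S assume "S \<subseteq> fst (U, F) \<and> card S < 3"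
  then have S: "S \<subseteq> U" "card S \<le> 2" by auto
  have "finite S" using S(1) fU by (rule finite_subset)
  then have "card (U - S) \<noteq> 0" using S cU by (simp add: card_Diff_subset)
  then have ne: "U - S \<noteq> {}" by force
  let ?R = "{(x, y). {x, y} \<in> snd (delete_verts (U, F) S)}"
  have "(u, v) \<in> ?R\<^sup>*" if "u \<in> U - S" "v \<in> U - S" for u v
  proof (rule ccontr)
    assume v: "(u, v) \<notin> ?R\<^sup>*"
    let ?P = "{w \<in> U - S. (u, w) \<in> ?R\<^sup>*}"
    let ?Q = "{w \<in> U - S. (u, w) \<notin> ?R\<^sup>*}"
    have "\<not> r p q" if p: "p \<in> ?P" and q: "q \<in> ?Q" for p q
    proof
      assume "r p q"
      moreover have "p \<noteq> q" using p q by auto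
      ultimately have "{p, q} \<in> F" using F p q by blast
      then have "(p, q) \<in> ?R" using p q by (simp add: delete_verts_def)
      moreover have "(u, p) \<in> ?R\<^sup>*" using p by blast
      ultimately have "(u, q) \<in> ?R\<^sup>*" by (rule rtrancl_into_rtrancl[rotated])
      then show False using q by blast
    qed
    moreover have "u \<in> ?P" "v \<in> ?Q" using that v by blast+
    ultimately have "sep r U ?P ?Q S" using S unfolding sep_def by blast
    then show False using assms(1) unfolding conn3_def by blast
  qed
  then show "connected_ugraph (delete_verts (U, F) S)"
    using ne unfolding connected_ugraph_def by (simp add: delete_verts_def)
qed

lemma k_connected_degree:
  assumes "wf_ugraph H" "k_connected k H" "v \<in> fst H" "{y. {v, y} \<in> snd H} \<subseteq> N" "finite N"
  shows "k \<le> card N"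
proof (rule ccontr)
  assume "\<not> k \<le> card N"
  let ?N = "{y. {v, y} \<in> snd H}"
  have "card ?N < k"
    using \<open>\<not> k \<le> card N\<close> card_mono[OF assms(5,4)] by simp
  have edge: "y \<in> fst H \<and> y \<noteq> v" if "{v, y} \<in> snd H" for y
    using that assms(1) by (auto simp: wf_ugraph_def all_edges_def card_insert_if split: if_splits)
  have fN: "finite ?N" using assms(4,5) by (rule finite_subset)
  have "?N \<subseteq> fst H" using edge by blast
  then have con: "connected_ugraph (delete_verts H ?N)"
    using assms(2) \<open>card ?N < k\<close> by (simp add: k_connected_def)
  have "card (insert v ?N) < card (fst H)"
    using assms(2) \<open>card ?N < k\<close> fN by (simp add: k_connected_def card_insert_if)
  then have "\<not> fst H \<subseteq> insert v ?N" using fN by (metis card_mono finite_insert leD)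
  then obtain w where w: "w \<in> fst H - ?N" "w \<noteq> v" by blast
  have "v \<in> fst H - ?N" using edge assms(3) by blast
  then have "(v, w) \<in> {(x, y). {x, y} \<in> snd (delete_verts H ?N)}\<^sup>*"
    using con w unfolding connected_ugraph_def by (simp add: delete_verts_def)
  then obtain z where "{v, z} \<in> snd (delete_verts H ?N)"
    using w(2) by (auto elim: converse_rtranclE)
  then show False by (auto simp: delete_verts_def)
qed

lemma finite_orders:
  "finite (insert 0 {card (fst H) | H.
     subgraph H (complete_ugraph n) \<and> k_connected k H \<and> monochromatic f H})"
proof (rule finite_subset)
  show "insert 0 {card (fst H) | H.
     subgraph H (complete_ugraph n) \<and> k_connected k H \<and> monochromatic f H} \<subseteq> {..n}"
    using card_mono[of "{1..n}"] by (fastforce simp: subgraph_def complete_ugraph_def)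
qed simp

lemma max_mono_order_ge:
  assumes "subgraph H (complete_ugraph n)" "k_connected k H" "monochromatic f H"
  shows "card (fst H) \<le> max_mono_order n k f"
  unfolding max_mono_order_def by (rule Max_ge[OF finite_orders]) (use assms in blast)

lemma max_mono_order_le:
  assumes "\<And>H. subgraph H (complete_ugraph n) \<Longrightarrow> k_connected k H \<Longrightarrow> monochromatic f H \<Longrightarrow>
    card (fst H) \<le> b"
  shows "max_mono_order n k f \<le> b"
  unfolding max_mono_order_def by (subst Max_le_iff[OF finite_orders]) (use assms in blast)+

lemma finite_colourings: "finite (colourings n r)"
  unfolding colourings_def complete_ugraph_def all_edges_def
  by (intro finite_PiE) (auto intro: finite_subset[of _ "Pow {1..n}"])

lemma max_mono_order_lower:
  assumes "9 \<le> n" "f \<in> colourings n 2"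
  shows "n - 4 \<le> max_mono_order n 3 f"
proof -
  let ?r = "\<lambda>x y. f {x, y} = 1"
  have "symp ?r" by (simp add: symp_def insert_commute)
  then obtain U where U: "U \<subseteq> {1..n}" "n \<le> card U + 4"
    and con: "conn3 ?r U \<or> conn3 (\<lambda>x y. \<not> ?r x y) U"
    using large_mono_conn3[of ?r "{1..n}"] assms(1) by auto
  have edge: "{x, y} \<in> all_edges U" if "x \<in> U" "y \<in> U" "x \<noteq> y" for x y
    using that by (simp add: all_edges_def)
  have col: "f e = 1 \<or> f e = 2" if "e \<in> all_edges U" for e
  proof -
    have "e \<in> all_edges {1..n}" using that U(1) by (auto simp: all_edges_def)
    then have "f e \<in> {1..2}" using assms(2) by (auto simp: colourings_def complete_ugraph_def)
    then show ?thesis by auto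
  qed
  have "\<exists>c. k_connected 3 (U, {e \<in> all_edges U. f e = c})"
    using con
  proof
    assume "conn3 ?r U"
    then have "k_connected 3 (U, {e \<in> all_edges U. f e = 1})"
      by (rule k_connected_3I) (use edge in blast)
    then show ?thesis ..
  next
    assume "conn3 (\<lambda>x y. \<not> ?r x y) U"
    then have "k_connected 3 (U, {e \<in> all_edges U. f e = 2})"
      by (rule k_connected_3I) (use edge col in blast)
    then show ?thesis ..
  qed
  then obtain c where c: "k_connected 3 (U, {e \<in> all_edges U. f e = c})" ..
  have "subgraph (U, {e \<in> all_edges U. f e = c}) (complete_ugraph n)"
    using U(1) by (auto simp: subgraph_def wf_ugraph_def complete_ugraph_def all_edges_def)
  moreover have "monochromatic f (U, {e \<in> all_edges U. f e = c})"
    by (auto simp: monochromatic_def)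
  ultimately show ?thesis using max_mono_order_ge[OF _ c] U(2) by fastforce
qed

text \<open>In colour 1 the vertices 1 to 4 have degree 2, and in colour 2 the vertices 5 to 8 do.\<close>

definition first_colour :: "nat set \<Rightarrow> bool" where
  "first_colour e \<longleftrightarrow> e \<inter> {1, 2, 3, 4} = {} \<or>
     e \<in> {{1, 5}, {1, 6}, {2, 5}, {2, 6}, {3, 7}, {3, 8}, {4, 7}, {4, 8}}"

definition extremal_colouring :: "nat \<Rightarrow> nat set \<Rightarrow> nat" where
  "extremal_colouring n = restrict (\<lambda>e. if first_colour e then 1 else 2) (all_edges {1..n})"

lemma first_colour_nbrs:
  "v \<in> {1, 2} \<Longrightarrow> first_colour {v, y} \<Longrightarrow> y \<in> {5, 6}"
  "v \<in> {3, 4} \<Longrightarrow> first_colour {v, y} \<Longrightarrow> y \<in> {7, 8}"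
  unfolding first_colour_def by (elim insertE; simp add: doubleton_eq_iff)+

lemma second_colour_nbrs:
  assumes "\<not> first_colour {v, y}"
  shows "v \<in> {5, 6} \<Longrightarrow> y \<in> {3, 4}" "v \<in> {7, 8} \<Longrightarrow> y \<in> {1, 2}"
proof -
  have X: "{v, y} \<inter> {1, 2, 3, 4} \<noteq> {}"
    using assms unfolding first_colour_def by (rule contrapos_nn) (rule disjI1)
  show "y \<in> {3, 4}" if v: "v \<in> {5, 6}"
  proof -
    have "y \<in> {1, 2, 3, 4}" using v X by auto
    then show ?thesis using v assms
      unfolding first_colour_def by (elim insertE) (simp_all add: doubleton_eq_iff)
  qed
  show "y \<in> {1, 2}" if v: "v \<in> {7, 8}"
  proof -
    have "y \<in> {1, 2, 3, 4}" using v X by auto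
    then show ?thesis using v assms
      unfolding first_colour_def by (elim insertE) (simp_all add: doubleton_eq_iff)
  qed
qed

lemma max_mono_order_extremal:
  assumes "9 \<le> n"
  shows "max_mono_order n 3 (extremal_colouring n) \<le> n - 4"
proof (rule max_mono_order_le)
  let ?f = "extremal_colouring n"
  fix H assume H: "subgraph H (complete_ugraph n)" "k_connected 3 H" "monochromatic ?f H"
  have wf: "wf_ugraph H" and sub: "fst H \<subseteq> {1..n}" and edges: "snd H \<subseteq> all_edges {1..n}"
    using H(1) by (auto simp: subgraph_def complete_ugraph_def)
  obtain c where c: "\<And>e. e \<in> snd H \<Longrightarrow> ?f e = c" using H(3) by (auto simp: monochromatic_def)
  have low: "v \<notin> fst H" if "\<And>y. {v, y} \<in> snd H \<Longrightarrow> y \<in> {a, b}" for v a b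
  proof
    assume "v \<in> fst H"
    moreover have "{y. {v, y} \<in> snd H} \<subseteq> {a, b}" using that by blast
    ultimately have "3 \<le> card {a, b}" using k_connected_degree[OF wf H(2)] by blast
    moreover have "card {a, b} \<le> 2" by (simp add: card_insert_if)
    ultimately show False by simp
  qed
  have f: "c = 1 \<longleftrightarrow> first_colour e" if "e \<in> snd H" for e
  proof -
    have "c = (if first_colour e then 1 else 2)"
      using c[OF that] edges that by (auto simp: extremal_colouring_def)
    then show ?thesis by simp
  qed
  have card4: "card (fst H) \<le> n - 4" if "fst H \<inter> A = {}" "A \<subseteq> {1..n}" "card A = 4" for A
  proof -
    have "card (fst H) \<le> card ({1..n} - A)" using sub that by (intro card_mono) auto
    also have "\<dots> = n - 4" using that by (simp add: card_Diff_subset finite_subset)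
    finally show ?thesis .
  qed
  show "card (fst H) \<le> n - 4"
  proof (cases "c = 1")
    case True
    have "v \<notin> fst H" if "v \<in> {1, 2}" for v
      using that True f first_colour_nbrs(1) by (intro low[of v 5 6]) blast
    moreover have "v \<notin> fst H" if "v \<in> {3, 4}" for v
      using that True f first_colour_nbrs(2) by (intro low[of v 7 8]) blast
    ultimately show ?thesis using assms by (intro card4[of "{1, 2, 3, 4}"]) auto
  next
    case False
    have "v \<notin> fst H" if "v \<in> {5, 6}" for v
      using that False f second_colour_nbrs(1) by (intro low[of v 3 4]) blast
    moreover have "v \<notin> fst H" if "v \<in> {7, 8}" for v
      using that False f second_colour_nbrs(2) by (intro low[of v 1 2]) blast
    ultimately show ?thesis using assms by (intro card4[of "{5, 6, 7, 8}"]) auto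
  qed
qed

theorem theorem2p6:
  fixes n :: nat
  assumes "n \<ge> 9"
  shows "m1 n 2 3 = n - 4"
proof (rule antisym)
  have mem: "extremal_colouring n \<in> colourings n 2"
    by (auto simp: extremal_colouring_def colourings_def complete_ugraph_def)
  then have "m1 n 2 3 \<le> max_mono_order n 3 (extremal_colouring n)"
    unfolding m1_def using finite_colourings by (intro Min_le) auto
  then show "m1 n 2 3 \<le> n - 4" using max_mono_order_extremal[OF assms] by linarith
  show "n - 4 \<le> m1 n 2 3"
    unfolding m1_def using max_mono_order_lower[OF assms] finite_colourings mem
    by (subst Min_ge_iff) auto
qed

end
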